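(* Let $(X,\rho)$ be a metric space and let $E_1,\dots,E_k\subset X$. If all $E_j$ (with the restricted metric) are uniformly disconnected, then $\bigcup_{j=1}^kE_j$ is also uniformly disconnected.
   Context: For $\delta_0>0$, a $\delta_0$-sequence in a metric space $(Y,\rho)$ is a sequence of distinct points $(x_0,x_1,\dots,x_n)$ of $Y$, $n\ge1$, with $\rho(x_i,x_{i+1})\le\delta_0\,\rho(x_0,x_n)$ for all $0\le i\le n-1$. $(Y,\rho)$ is uniformly disconnected if there is $\delta_0>0$ such that no $\delta_0$-sequence exists in $Y$. *)

theory Defs
  imports "HOL-Analysis.Analysis"
begin

(* The finite sequence (x_0, ..., x_n) is encoded by its length parameter n and a function x
   on nat; the values of x beyond index n are irrelevant. *)
definition delta_sequence :: "real \<Rightarrow> 'a metric \<Rightarrow> nat \<Rightarrow> (nat \<Rightarrow> 'a) \<Rightarrow> bool" where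
  "delta_sequence \<delta> Y n x \<longleftrightarrow>
     n \<ge> 1 \<and> (\<forall>i\<le>n. x i \<in> mspace Y) \<and> inj_on x {0..n} \<and>
     (\<forall>i<n. mdist Y (x i) (x (Suc i)) \<le> \<delta> * mdist Y (x 0) (x n))"

definition uniformly_disconnected :: "'a metric \<Rightarrow> bool" where
  "uniformly_disconnected Y \<longleftrightarrow> (\<exists>\<delta>>0. \<not> (\<exists>n x. delta_sequence \<delta> Y n x))"

end

theory Submission
  imports Defs
begin

text \<open>
  Uniform disconnectedness says that the endpoints of any chain with steps at most \<open>s\<close> are
  at distance \<open>O(s)\<close>. Given such a chain in \<open>A \<union> B\<close>, each maximal run of points
  of \<open>B\<close> has its endpoints at distance \<open>O(s)\<close>, so the points of \<open>A\<close> form a chain with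
  steps \<open>O(s)\<close>, whose endpoints are again at distance \<open>O(s)\<close>.
\<close>

text \<open>Chains are handled as paths in this relation, so points may repeat. Unlike the sequences
  of distinct points in \<open>delta_sequence\<close>, they can be extended and concatenated
  freely.\<close>

definition chain_step :: "'a metric \<Rightarrow> 'a set \<Rightarrow> real \<Rightarrow> ('a \<times> 'a) set" where
  "chain_step X S s = {(x, y). x \<in> S \<and> y \<in> S \<and> mdist X x y \<le> s}"

text \<open>A linear form of uniform disconnectedness. Membership of \<open>x\<close> is asked
  separately because the reflexive closure relates every point to itself; membership of
  \<open>y\<close> then follows.\<close>

definition chain_bound :: "'a metric \<Rightarrow> 'a set \<Rightarrow> real \<Rightarrow> bool" where
  "chain_bound X S C \<longleftrightarrow>
     (\<forall>s\<ge>0. \<forall>x\<in>S. \<forall>y. (x, y) \<in> (chain_step X S s)\<^sup>* \<longrightarrow> mdist X x y \<le> C * s)"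

lemma chain_boundD:
  assumes "chain_bound X S C" "s \<ge> 0" "x \<in> S" "(x, y) \<in> (chain_step X S s)\<^sup>*"
  shows "mdist X x y \<le> C * s"
  using assms unfolding chain_bound_def by blast

lemma mdist_self: "x \<in> mspace X \<Longrightarrow> mdist X x x = 0"
  by simp

lemma rtrancl_chain_step_in:
  assumes "(x, y) \<in> (chain_step X S s)\<^sup>*" "x \<in> S"
  shows "y \<in> S"
  using assms by (induction rule: rtrancl_induct) (auto simp: chain_step_def)

text \<open>A path of least length visits no point twice, since the loop between two visits could be
  cut out. This recovers the distinctness that \<open>delta_sequence\<close> demands.\<close>

lemma rtrancl_imp_inj_path:
  assumes "(x, y) \<in> R\<^sup>*"
  obtains n f where "f 0 = x" "f n = y" "\<And>i. i < n \<Longrightarrow> (f i, f (Suc i)) \<in> R"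
    "inj_on f {0..n}"
proof -
  define n where "n = (LEAST n. (x, y) \<in> R ^^ n)"
  have least: "n \<le> m" if "(x, y) \<in> R ^^ m" for m
    unfolding n_def using that by (rule Least_le)
  have "(x, y) \<in> R ^^ n"
    unfolding n_def using assms by (metis LeastI rtrancl_imp_relpow)
  then obtain f where f: "f 0 = x" "f n = y" "\<And>i. i < n \<Longrightarrow> (f i, f (Suc i)) \<in> R"
    by (auto simp: relpow_fun_conv)
  have path: "(f i, f (i + m)) \<in> R ^^ m" if "i + m \<le> n" for i m
    unfolding relpow_fun_conv using that f(3) by (intro exI[of _ "\<lambda>j. f (i + j)"]) auto
  have False if "i < j" "j \<le> n" "f i = f j" for i j
  proof -
    have "(x, f i) \<in> R ^^ i" "(f j, y) \<in> R ^^ (n - j)"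
      using path[of 0 i] path[of j "n - j"] that f by auto
    then have "(x, y) \<in> R ^^ (i + (n - j))"
      unfolding relpow_add using that(3) by auto
    then show False
      using least[of "i + (n - j)"] that by simp
  qed
  then have "inj_on f {0..n}"
    by (intro linorder_inj_onI) auto
  with f show thesis by (rule that)
qed

text \<open>The constant is \<open>1 / \<delta>\<close>: if the endpoints of a chain were further
  apart than \<open>s / \<delta>\<close>, an injective path between them would be a
  \<open>delta_sequence\<close>.\<close>

lemma uniformly_disconnected_imp_chain_bound:
  assumes "S \<subseteq> mspace X" "uniformly_disconnected (submetric X S)"
  shows "\<exists>C\<ge>0. chain_bound X S C"
proof -
  obtain \<delta> where \<delta>: "\<delta> > 0" "\<And>n x. \<not> delta_sequence \<delta> (submetric X S) n x"
    using assms(2) unfolding uniformly_disconnected_def by blast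
  have "mdist X x y \<le> 1 / \<delta> * s"
    if s: "s \<ge> 0" and x: "x \<in> S" and xy: "(x, y) \<in> (chain_step X S s)\<^sup>*" for s x y
  proof (rule ccontr)
    assume "\<not> ?thesis"
    then have large: "s < \<delta> * mdist X x y"
      using \<delta>(1) by (simp add: field_simps)
    obtain n f where f: "f 0 = x" "f n = y" "\<And>i. i < n \<Longrightarrow> (f i, f (Suc i)) \<in> chain_step X S s"
      "inj_on f {0..n}"
      using xy by (rule rtrancl_imp_inj_path) blast
    have "n \<noteq> 0"
      using f(1,2) large s x assms(1) by (intro notI) (simp add: mdist_self subset_iff)
    \<comment> \<open>No step leaves the last point \<open>f n\<close>, so its membership is read
      off the step that enters it.\<close>
    have "f i \<in> S" if "i \<le> n" for i
      using f(3)[of i] f(3)[of "i - 1"] that \<open>n \<noteq> 0\<close> unfolding chain_step_def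
      by (cases "i < n") auto
    moreover have "mdist X (f i) (f (Suc i)) \<le> \<delta> * mdist X (f 0) (f n)" if "i < n" for i
      using f(3)[OF that] large f(1,2) unfolding chain_step_def by auto
    ultimately have "delta_sequence \<delta> (submetric X S) n f"
      unfolding delta_sequence_def using \<open>n \<noteq> 0\<close> f(4) assms(1) by auto
    then show False using \<delta>(2) by blast
  qed
  then have "chain_bound X S (1 / \<delta>)"
    unfolding chain_bound_def by blast
  then show ?thesis
    using \<delta>(1) by (intro exI[of _ "1 / \<delta>"]) auto
qed

text \<open>A \<open>delta_sequence\<close> for \<open>1 / (C + 1)\<close> with endpoints at
  distance \<open>D\<close> is a chain with steps at most \<open>D / (C + 1)\<close>, so
  \<open>D \<le> C * D / (C + 1)\<close>. This is absurd because distinctness forces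
  \<open>D > 0\<close>. Taking \<open>C + 1\<close> makes the inequality strict and allows
  \<open>C = 0\<close>.\<close>

lemma chain_bound_imp_uniformly_disconnected:
  assumes S: "S \<subseteq> mspace X" and C: "C \<ge> 0" "chain_bound X S C"
  shows "uniformly_disconnected (submetric X S)"
  unfolding uniformly_disconnected_def
proof (intro exI conjI notI)
  show "1 / (C + 1) > 0" using C by simp
next
  assume "\<exists>n x. delta_sequence (1 / (C + 1)) (submetric X S) n x"
  then obtain n x where "delta_sequence (1 / (C + 1)) (submetric X S) n x" by blast
  then have n: "n \<ge> 1" and x: "\<And>i. i \<le> n \<Longrightarrow> x i \<in> S" "inj_on x {0..n}"
    and step: "\<And>i. i < n \<Longrightarrow> mdist X (x i) (x (Suc i)) \<le> mdist X (x 0) (x n) / (C + 1)"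
    unfolding delta_sequence_def by auto
  define D where "D = mdist X (x 0) (x n)"
  have "x 0 \<noteq> x n"
    using inj_onD[OF x(2), of 0 n] n by auto
  then have D: "D > 0"
    unfolding D_def using x(1)[of 0] x(1)[of n] S mdist_zero[of "x 0" X "x n"]
      mdist_nonneg[of X "x 0" "x n"] by (auto simp: subset_iff less_le)
  have "(x 0, x n) \<in> (chain_step X S (D / (C + 1))) ^^ n"
    unfolding relpow_fun_conv chain_step_def D_def using x(1) step
    by (intro exI[of _ x]) auto
  then have "D \<le> C * (D / (C + 1))"
    using chain_boundD[OF C(2), of "D / (C + 1)" "x 0" "x n"] D C(1) x(1) relpow_imp_rtrancl
    unfolding D_def by fastforce
  also have "\<dots> < D"
    using D C(1) by (simp add: field_simps)
  finally show False by simp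
qed

text \<open>The constant adds up the parts of a chain that meets \<open>A\<close>: at most
  \<open>(CB + 1) * s\<close> before \<open>a\<close>, at most \<open>CA * (CB + 2) * s\<close> from
  \<open>a\<close> to \<open>b\<close>, and at most \<open>(CB + 1) * s\<close> after
  \<open>b\<close>.\<close>

lemma chain_bound_Un:
  assumes A: "A \<subseteq> mspace X" "CA \<ge> 0" "chain_bound X A CA"
    and B: "B \<subseteq> mspace X" "CB \<ge> 0" "chain_bound X B CB"
  shows "chain_bound X (A \<union> B) (CA * (CB + 2) + 2 * (CB + 1))"
  unfolding chain_bound_def
proof (intro allI impI ballI)
  fix s x y
  assume s: "(0::real) \<le> s" and x: "x \<in> A \<union> B"
    and xy: "(x, y) \<in> (chain_step X (A \<union> B) s)\<^sup>*"
  \<comment> \<open>Two successive points of \<open>A\<close> are separated by at most one step into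
    \<open>B\<close>, a run in \<open>B\<close> of extent at most \<open>CB * s\<close>, and one
    step back: \<open>(CB + 2) * s\<close> in total.\<close>
  define RA where "RA = chain_step X A ((CB + 2) * s)"
  define RB where "RB = chain_step X B s"
  have triangle: "mdist X u w \<le> mdist X u v + mdist X v w"
    if "u \<in> A \<union> B" "v \<in> A \<union> B" "w \<in> A \<union> B" for u v w
    using mdist_triangle[of u X v w] that A(1) B(1) by blast
  have RB_dist: "mdist X u v \<le> CB * s" "v \<in> B" if "u \<in> B" "(u, v) \<in> RB\<^sup>*" for u v
    using that chain_boundD[OF B(3) s] rtrancl_chain_step_in unfolding RB_def by metis+
  have RA_dist: "mdist X u v \<le> CA * ((CB + 2) * s)" "v \<in> A" if "u \<in> A" "(u, v) \<in> RA\<^sup>*" for u v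
    using that chain_boundD[OF A(3), of "(CB + 2) * s"] s B(2) rtrancl_chain_step_in
    unfolding RA_def by fastforce+
  have CBs: "0 \<le> CB * s" using s B(2) by simp
  \<comment> \<open>This records the chain since its latest point \<open>b\<close> of
    \<open>A\<close>. The entry step from \<open>b\<close> to \<open>c\<close> is kept apart from
    \<open>RB\<close> because \<open>b\<close> need not lie in \<open>B\<close>.\<close>
  define tail where "tail b z \<longleftrightarrow> z = b \<or> (\<exists>c\<in>B. mdist X b c \<le> s \<and> (c, z) \<in> RB\<^sup>*)" for b z
  have tail_dist: "mdist X b z \<le> (CB + 1) * s" "z \<in> A \<union> B" if "tail b z" "b \<in> A" for b z
  proof -
    have "mdist X b z \<le> (CB + 1) * s \<and> z \<in> A \<union> B"
    proof (cases "z = b")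
      case True
      then show ?thesis using that A(1) s B(2) by (auto simp: mdist_self subset_iff)
    next
      case False
      then obtain c where c: "c \<in> B" "mdist X b c \<le> s" "(c, z) \<in> RB\<^sup>*"
        using \<open>tail b z\<close> unfolding tail_def by blast
      show ?thesis
        using triangle[of b c z] c RB_dist[OF c(1,3)] that by (auto simp: algebra_simps)
    qed
    then show "mdist X b z \<le> (CB + 1) * s" "z \<in> A \<union> B" by auto
  qed
  \<comment> \<open>\<open>a\<close> and \<open>b\<close> are the first and the last point of \<open>A\<close> on the chain from \<open>x\<close> to \<open>y\<close>.\<close>
  have "(x \<in> B \<and> (x, y) \<in> RB\<^sup>*) \<or>
      (\<exists>a\<in>A. \<exists>b\<in>A. mdist X x a \<le> (CB + 1) * s \<and> (a, b) \<in> RA\<^sup>* \<and> tail b y)"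
    using xy
  proof (induction rule: rtrancl_induct)
    case base
    show ?case
    \<comment> \<open>Points of the overlap count as points of \<open>B\<close> until the chain
      first leaves \<open>B\<close>, and as points of \<open>A\<close> from then on.\<close>
    proof (cases "x \<in> B")
      case False
      then have "x \<in> A" "mdist X x x \<le> (CB + 1) * s" using x A(1) s B(2) by (auto simp: mdist_self subset_iff)
      then show ?thesis unfolding tail_def by blast
    qed simp
  next
    case (step y z)
    have yz: "y \<in> A \<union> B" "z \<in> A \<union> B" "mdist X y z \<le> s"
      using step.hyps(2) unfolding chain_step_def by auto
    from step.IH show ?case
    proof (elim disjE conjE bexE)
      assume xB: "x \<in> B" "(x, y) \<in> RB\<^sup>*"
      note y = RB_dist[OF xB]
      show ?thesis
      proof (cases "z \<in> B")
        case True
        then have "(y, z) \<in> RB" using yz y unfolding RB_def chain_step_def by simp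
        then show ?thesis using xB by (meson rtrancl.rtrancl_into_rtrancl)
      next
        case False
        then have "z \<in> A" using yz by blast
        moreover have "mdist X x z \<le> (CB + 1) * s"
          using triangle[of x y z] x yz y by (simp add: algebra_simps)
        ultimately show ?thesis unfolding tail_def by blast
      qed
    next
      fix a b
      assume ab: "a \<in> A" "b \<in> A" "mdist X x a \<le> (CB + 1) * s" "(a, b) \<in> RA\<^sup>*" "tail b y"
      show ?thesis
      proof (cases "z \<in> A")
        case True
        have "mdist X b z \<le> (CB + 2) * s"
          using triangle[of b y z] tail_dist[OF ab(5,2)] ab yz by (simp add: algebra_simps)
        then have "(b, z) \<in> RA" using True ab unfolding RA_def chain_step_def by simp
        then have "(a, z) \<in> RA\<^sup>*" using ab by (meson rtrancl.rtrancl_into_rtrancl)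
        then show ?thesis using ab True unfolding tail_def by blast
      next
        case False
        then have z: "z \<in> B" using yz by blast
        have "tail b z"
        proof (cases "y = b")
          \<comment> \<open>Here \<open>z\<close> opens a new run in \<open>B\<close> and serves as
            its own entry point \<open>c\<close>.\<close>
          case True
          then show ?thesis unfolding tail_def using z yz by blast
        next
          case False
          then obtain c where c: "c \<in> B" "mdist X b c \<le> s" "(c, y) \<in> RB\<^sup>*"
            using ab(5) unfolding tail_def by blast
          then have "(y, z) \<in> RB"
            using yz z RB_dist[OF c(1,3)] unfolding RB_def chain_step_def by simp
          then show ?thesis
            using c unfolding tail_def by (meson rtrancl.rtrancl_into_rtrancl)
        qed
        then show ?thesis using ab by blast
      qed
    qed
  qed
  then show "mdist X x y \<le> (CA * (CB + 2) + 2 * (CB + 1)) * s"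
  proof (elim disjE conjE bexE)
    assume "x \<in> B" "(x, y) \<in> RB\<^sup>*"
    then have "mdist X x y \<le> CB * s" by (rule RB_dist)
    also have "\<dots> \<le> (CA * (CB + 2) + 2 * (CB + 1)) * s"
      using A(2) B(2) s by (intro mult_right_mono) (auto intro: add_increasing)
    finally show ?thesis .
  next
    fix a b
    assume ab: "a \<in> A" "b \<in> A" "mdist X x a \<le> (CB + 1) * s" "(a, b) \<in> RA\<^sup>*" "tail b y"
    have "mdist X x y \<le> mdist X x a + mdist X a b + mdist X b y"
      using triangle[of x a y] triangle[of a b y] x ab tail_dist[OF ab(5,2)] by simp
    also have "\<dots> \<le> (CB + 1) * s + CA * ((CB + 2) * s) + (CB + 1) * s"
      using ab RA_dist(1)[OF ab(1,4)] tail_dist(1)[OF ab(5,2)] by linarith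
    also have "\<dots> = (CA * (CB + 2) + 2 * (CB + 1)) * s"
      by (simp add: algebra_simps)
    finally show ?thesis .
  qed
qed

lemma uniformly_disconnected_Un:
  assumes "A \<subseteq> mspace X" "uniformly_disconnected (submetric X A)"
    and "B \<subseteq> mspace X" "uniformly_disconnected (submetric X B)"
  shows "uniformly_disconnected (submetric X (A \<union> B))"
proof -
  obtain CA CB where "CA \<ge> 0" "chain_bound X A CA" "CB \<ge> 0" "chain_bound X B CB"
    using uniformly_disconnected_imp_chain_bound assms by metis
  then show ?thesis
    using assms chain_bound_Un[of A X CA B CB]
    by (intro chain_bound_imp_uniformly_disconnected) auto
qed

text \<open>Every \<open>delta_sequence\<close> has a point \<open>x 0\<close> in the space, so any
  positive constant works. This starts the induction on the index set and covers
  \<open>k = 0\<close>.\<close>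

lemma uniformly_disconnected_empty: "uniformly_disconnected (submetric X {})"
  unfolding uniformly_disconnected_def delta_sequence_def by (auto intro: exI[of _ 1])

lemma uniformly_disconnected_UN:
  assumes "finite I" "\<And>i. i \<in> I \<Longrightarrow> E i \<subseteq> mspace X"
    "\<And>i. i \<in> I \<Longrightarrow> uniformly_disconnected (submetric X (E i))"
  shows "uniformly_disconnected (submetric X (\<Union>i\<in>I. E i))"
  using assms
proof (induction I rule: finite_induct)
  case empty
  show ?case using uniformly_disconnected_empty by simp
next
  case (insert i I)
  then have "uniformly_disconnected (submetric X (E i \<union> (\<Union>i\<in>I. E i)))"
    by (intro uniformly_disconnected_Un) auto
  then show ?case by simp
qed

theorem theorem1p5:
  fixes X :: "'a metric" and k :: nat and E :: "nat \<Rightarrow> 'a set"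
  assumes "\<And>j. j \<in> {1..k} \<Longrightarrow> E j \<subseteq> mspace X"
    and "\<And>j. j \<in> {1..k} \<Longrightarrow> uniformly_disconnected (submetric X (E j))"
  shows "uniformly_disconnected (submetric X (\<Union>j\<in>{1..k}. E j))"
  using assms by (intro uniformly_disconnected_UN) auto

end
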